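(* Let $(x(t),y(t))_{t\ge t_0}$ be a global solution of the dynamical system $$\begin{cases}\ddot{x}(t)+\frac{\alpha}{t^q}\dot{x}(t)+\beta(t)\left(\nabla_{x}\mathcal{L}\left(x(t),y(t)+\frac{t^q}{\alpha-1}\dot{y}(t)\right)+\frac{c}{t^p}x(t)\right)=0,\\ \ddot{y}(t)+\frac{\alpha}{t^q}\dot{y}(t)-\beta(t)\left(\nabla_y \mathcal{L}\left(x(t)+\frac{t^q}{\alpha-1}\dot{x}(t),y(t)\right)-\frac{c}{t^p}y(t)\right)=0.\end{cases}$$ Suppose that for any $t\ge t_0$, $$\frac{\dot\beta(t)}{\beta(t)}\le \frac{\alpha-1}{t^q}-\frac{2q}{t},\qquad \frac{q(1-q)}{c}\le t^{2-p}\beta(t),$$ and that $$\int_{t_0}^{+\infty} t^{q-p}\beta(t)\,dt<+\infty.$$ Then, for any $(x^*,y^* )\in\Omega$, the trajectory $(x(t),y(t))_{t\ge t_0}$ is bounded and $$\mathcal{L}(x(t),y^* )-\mathcal{L}(x^*,y(t))=\mathcal{O}\left(\frac{1}{t^{2q}\beta(t)}\right)\quad\text{as } t\to+\infty,$$ $$\|\dot x(t)\|=\mathcal{O}\left(\frac1{t^q}\right),\quad \|\dot y(t)\|=\mathcal{O}\left(\frac1{t^q}\right)\quad\text{as } t\to+\infty,$$ and $$\int_{t_0}^{+\infty} t^q\left(\|\dot x(t)\|^2+\|\dot y(t)\|^2\right)dt<+\infty.$$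
   Context: $f:\mathbb{R}^n\to\mathbb{R}$ and $g:\mathbb{R}^m\to\mathbb{R}$ are continuously differentiable convex functions, $K:\mathbb{R}^n\to\mathbb{R}^m$ is a (continuous) linear operator, and $\mathcal{L}(x,y)=f(x)+\langle Kx,y\rangle-g(y)$ for $(x,y)\in\mathbb{R}^n\times\mathbb{R}^m$; the saddle point problem is $\min_{x}\max_{y}\mathcal{L}(x,y)$. $\nabla_x\mathcal{L}$ and $\nabla_y\mathcal{L}$ are the partial gradients, so $\nabla_x\mathcal{L}(x,y)=\nabla f(x)+K^*y$ and $\nabla_y\mathcal{L}(x,y)=Kx-\nabla g(y)$, where $K^*$ is the adjoint of $K$. $\Omega$ is the set of saddle points of $\mathcal{L}$, i.e. of pairs $(x^*,y^* )$ with $\mathcal{L}(x^*,y)\le\mathcal{L}(x^*,y^* )\le\mathcal{L}(x,y^* )$ for all $(x,y)\in\mathbb{R}^n\times\mathbb{R}^m$; it is assumed that $\Omega\ne\emptyset$. Norms are Euclidean. Standing parameters: $t_0>0$, $\alpha>1$, $0<q<1$, $p>0$, $c>0$, and $\beta:[t_0,+\infty)\to(0,+\infty)$ is continuously differentiable and nondecreasing. A global solution is a twice differentiable trajectory satisfying the system for all $t\ge t_0$. *)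

theory Defs
  imports "HOL-Analysis.Analysis" "HOL-Library.Landau_Symbols"
begin

text \<open>Only meaningful where the function is differentiable; see \<open>gradient_eqI\<close>.\<close>

definition gradient :: "('a::euclidean_space \<Rightarrow> real) \<Rightarrow> 'a \<Rightarrow> 'a" where
  "gradient f x = (THE D. GDERIV f x :> D)"

definition C1_function :: "('a::euclidean_space \<Rightarrow> real) \<Rightarrow> bool" where
  "C1_function f \<longleftrightarrow> (\<forall>x. f differentiable (at x)) \<and> continuous_on UNIV (gradient f)"

definition lagrangian ::
    "('a::euclidean_space \<Rightarrow> real) \<Rightarrow> ('a \<Rightarrow> 'b) \<Rightarrow> ('b::euclidean_space \<Rightarrow> real) \<Rightarrow> 'a \<Rightarrow> 'b \<Rightarrow> real" where
  "lagrangian f K g x y = f x + K x \<bullet> y - g y"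

definition gradient_x ::
    "('a::euclidean_space \<Rightarrow> 'b::euclidean_space \<Rightarrow> real) \<Rightarrow> 'a \<Rightarrow> 'b \<Rightarrow> 'a" where
  "gradient_x L x y = gradient (\<lambda>u. L u y) x"

definition gradient_y ::
    "('a::euclidean_space \<Rightarrow> 'b::euclidean_space \<Rightarrow> real) \<Rightarrow> 'a \<Rightarrow> 'b \<Rightarrow> 'b" where
  "gradient_y L x y = gradient (\<lambda>v. L x v) y"

definition saddle_points :: "('a \<Rightarrow> 'b \<Rightarrow> real) \<Rightarrow> ('a \<times> 'b) set" where
  "saddle_points L = {(xs, ys). \<forall>x y. L xs y \<le> L xs ys \<and> L xs ys \<le> L x ys}"

lemma gradient_eqI:
  assumes "GDERIV f x :> D"
  shows "gradient f x = D"
  unfolding gradient_def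
proof (rule the_equality)
  fix D' assume "GDERIV f x :> D'"
  then have "(\<lambda>h. h \<bullet> D') = (\<lambda>h. h \<bullet> D)"
    using assms unfolding gderiv_def by (rule has_derivative_unique)
  then have "\<And>h. h \<bullet> D' = h \<bullet> D" by meson
  then show "D' = D" by (metis inner_commute vector_eq_rdot)
qed (fact assms)

lemma GDERIV_gradient:
  assumes "f differentiable (at x)"
  shows "GDERIV f x :> gradient f x"
proof -
  obtain F where F: "(f has_derivative F) (at x)"
    using assms unfolding differentiable_def by blast
  then have lin: "linear F" by (rule has_derivative_linear)
  have "F = (\<lambda>h. h \<bullet> adjoint F 1)"
    using adjoint_works[OF lin, of _ 1] by (simp add: fun_eq_iff)
  with F have "GDERIV f x :> adjoint F 1" unfolding gderiv_def by simp
  then show ?thesis using gradient_eqI by metis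
qed

lemma gradient_x_lagrangian:
  assumes "f differentiable (at x)" "linear K"
  shows "gradient_x (lagrangian f K g) x y = gradient f x + adjoint K y"
  unfolding gradient_x_def
proof (rule gradient_eqI)
  have "bounded_linear K" using assms(2) by (simp add: linear_conv_bounded_linear)
  note K = bounded_linear_imp_has_derivative[OF this, of "at x"]
  show "GDERIV (\<lambda>u. lagrangian f K g u y) x :> gradient f x + adjoint K y"
    unfolding gderiv_def lagrangian_def
    by (rule has_derivative_eq_rhs, (rule derivative_intros K GDERIV_gradient[OF assms(1), unfolded gderiv_def])+)
       (simp add: fun_eq_iff inner_add_right adjoint_works[OF assms(2)])
qed

lemma gradient_y_lagrangian:
  assumes "g differentiable (at y)"
  shows "gradient_y (lagrangian f K g) x y = K x - gradient g y"
  unfolding gradient_y_def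
proof (rule gradient_eqI)
  show "GDERIV (\<lambda>v. lagrangian f K g x v) y :> K x - gradient g y"
    unfolding gderiv_def lagrangian_def
    by (rule has_derivative_eq_rhs, (rule derivative_intros GDERIV_gradient[OF assms(1), unfolded gderiv_def])+)
       (simp add: fun_eq_iff inner_diff_right inner_commute)
qed

end

theory Submission
  imports Defs
begin

text \<open>
  The proof is a Lyapunov argument. Fix a saddle point \<open>(xs, ys)\<close> and put \<open>a = \<alpha> - 1\<close> and
  \<open>r(t) = t\<^sup>q\<close>. The energy is

    \<open>E = r\<^sup>2 \<beta> (L(x, ys) - L(xs, y)) + B\<^sub>x + B\<^sub>y\<close>,

  where \<open>B\<^sub>x = \<bar>r x' + a (x - xs)\<bar>\<^sup>2 / 2 + a/2 (1 - q r/t) \<bar>x - xs\<bar>\<^sup>2 + c/2 r\<^sup>2 t\<^sup>-\<^sup>p \<beta> \<bar>x\<bar>\<^sup>2\<close>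
  (\<open>block_energy\<close>), and \<open>B\<^sub>y\<close> is the same expression in \<open>y\<close>. All three summands are nonnegative
  once \<open>t \<ge> 1\<close>, the first because the gap at a saddle point is nonnegative.

  The two equations have the same shape, a damped equation driven by an abstract force \<open>G\<close>, with
  \<open>G = \<nabla>\<^sub>xL\<close> in one and \<open>G = - \<nabla>\<^sub>yL\<close> in the other. So one computation (\<open>block_energy_decay\<close>)
  treats both blocks. It bounds the derivative of a block by the sum of the dissipation \<open>- (1 - q) r \<bar>x'\<bar>\<^sup>2\<close>, the source
  \<open>a c/2 t\<^sup>q\<^sup>-\<^sup>p \<beta> \<bar>xs\<bar>\<^sup>2\<close>, which is integrable by hypothesis, and the power of the force,
  \<open>- r \<beta> \<langle>r x' + a (x - xs), G\<rangle>\<close>. The powers of both forces add up to at most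
  \<open>- r \<beta> (r gap' + a gap)\<close> (\<open>lagrangian_gap_pairing\<close>): the extrapolated arguments
  \<open>x + (r/a) x'\<close> and \<open>y + (r/a) y'\<close> are such that the quadratic coupling terms cancel, and the
  rest is convexity of \<open>f\<close> and \<open>g\<close>. The growth condition on \<open>\<beta>\<close> says exactly that
  \<open>(r\<^sup>2 \<beta>)' \<le> a r \<beta>\<close>, so this absorbs the derivative of the first summand of \<open>E\<close>.

  Hence \<open>E' + (1 - q) r (\<bar>x'\<bar>\<^sup>2 + \<bar>y'\<bar>\<^sup>2)\<close> is at most an integrable function, and integration
  (\<open>dissipation_bound\<close>) bounds \<open>E\<close> together with the integral of the dissipation. Each claim is
  the bound on one of these nonnegative quantities.
\<close>

section \<open>Derivatives along curves and convexity\<close>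

lemma has_real_derivative_norm_power2:
  fixes z :: "real \<Rightarrow> 'a::real_inner"
  assumes "(z has_vector_derivative z') (at t)"
  shows "((\<lambda>t. (norm (z t))\<^sup>2) has_real_derivative 2 * (z t \<bullet> z')) (at t)"
proof -
  have "((\<lambda>t. z t \<bullet> z t) has_derivative (\<lambda>h. z t \<bullet> (h *\<^sub>R z') + (h *\<^sub>R z') \<bullet> z t)) (at t)"
    using assms unfolding has_vector_derivative_def by (auto intro!: derivative_eq_intros)
  then show ?thesis
    unfolding has_field_derivative_def power2_norm_eq_inner
    by (rule has_derivative_eq_rhs) (auto simp: inner_commute)
qed

lemma has_real_derivative_along_curve:
  assumes "h differentiable (at (z t))" and "(z has_vector_derivative z') (at t)"
  shows "((\<lambda>t. h (z t)) has_real_derivative gradient h (z t) \<bullet> z') (at t)"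
proof -
  have "((\<lambda>t. h (z t)) has_derivative (\<lambda>s. (s *\<^sub>R z') \<bullet> gradient h (z t))) (at t)"
    by (rule has_derivative_compose[OF assms(2)[unfolded has_vector_derivative_def]
          GDERIV_gradient[OF assms(1), unfolded gderiv_def]])
  then show ?thesis
    unfolding has_field_derivative_def
    by (rule has_derivative_eq_rhs) (auto simp: inner_commute)
qed

text \<open>Restricting to the segment from \<open>z\<close> to \<open>w\<close> reduces this to the tangent inequality for
  convex functions of one real variable.\<close>

lemma convex_on_above_gradient:
  assumes "convex_on UNIV h" and "h differentiable (at z)"
  shows "h z - h w \<le> gradient h z \<bullet> (z - w)"
proof -
  let ?l = "\<lambda>s. z + s *\<^sub>R (w - z)"
  have "convex_on UNIV (\<lambda>s. h (?l s))"
  proof (rule convex_onI)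
    fix s r r' :: real assume s: "0 < s" "s < 1"
    have "?l ((1 - s) *\<^sub>R r + s *\<^sub>R r') = (1 - s) *\<^sub>R ?l r + s *\<^sub>R ?l r'"
      by (simp add: algebra_simps)
    then show "h (?l ((1 - s) *\<^sub>R r + s *\<^sub>R r')) \<le> (1 - s) * h (?l r) + s * h (?l r')"
      using convex_onD[OF assms(1), of s "?l r" "?l r'"] s by simp
  qed simp
  moreover have "(?l has_vector_derivative (w - z)) (at 0)"
    by (auto intro!: derivative_eq_intros)
  then have "((\<lambda>s. h (?l s)) has_real_derivative gradient h z \<bullet> (w - z)) (at 0)"
    using has_real_derivative_along_curve[of h ?l 0 "w - z"] assms(2) by simp
  ultimately have "gradient h z \<bullet> (w - z) * (1 - 0) \<le> h (?l 1) - h (?l 0)"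
    by (intro convex_on_imp_above_tangent[where A = UNIV]) auto
  then show ?thesis by (simp add: inner_diff_right)
qed

section \<open>Integrating a dissipation inequality\<close>

text \<open>Monotone convergence along the truncations of \<open>h\<close> to \<open>{a..n}\<close>.\<close>

lemma set_integrable_if_bounded_integrals:
  fixes h :: "real \<Rightarrow> real"
  assumes cont: "continuous_on {a..} h" and nonneg: "\<And>s. a \<le> s \<Longrightarrow> 0 \<le> h s"
    and bound: "\<And>t. T \<le> t \<Longrightarrow> integral {a..t} h \<le> B"
  shows "set_integrable lborel {a..} h"
proof -
  have int: "h integrable_on {a..t}" for t
    by (rule integrable_continuous_interval) (rule continuous_on_subset[OF cont], auto)
  have bdd: "integral {a..t} h \<le> B" for t
  proof -
    have "integral {a..t} h \<le> integral {a..max t T} h"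
      by (rule integral_subset_le) (use int nonneg in auto)
    also have "\<dots> \<le> B" using bound by simp
    finally show ?thesis .
  qed
  let ?h = "\<lambda>n s. if s \<in> {a..real n} then h s else 0"
  have eq: "integral {a..} (?h n) = integral {a..real n} h" for n
  proof -
    have "integral {a..} (?h n) = integral ({a..real n} \<inter> {a..}) h"
      by (rule integral_restrict_Int)
    also have "{a..real n} \<inter> {a..} = {a..real n}" by auto
    finally show ?thesis .
  qed
  have "h integrable_on {a..} \<and> (\<lambda>n. integral {a..} (?h n)) \<longlonglongrightarrow> integral {a..} h"
  proof (rule monotone_convergence_increasing)
    fix n
    have "{a..real n} \<inter> {a..} = {a..real n}" by auto
    then show "?h n integrable_on {a..}"
      using int by (subst integrable_restrict_Int) simp
  next
    fix s assume s: "s \<in> {a..}"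
    obtain N :: nat where "s \<le> real N" using real_arch_simple by blast
    then have "\<forall>\<^sub>F n in sequentially. ?h n s = h s"
      using s by (intro eventually_sequentiallyI[of N]) auto
    then show "(\<lambda>n. ?h n s) \<longlonglongrightarrow> h s" by (rule tendsto_eventually)
  next
    show "bounded (range (\<lambda>n. integral {a..} (?h n)))"
      unfolding eq using bdd integral_nonneg[OF int] nonneg
      by (intro boundedI[where B = B]) (auto simp: abs_of_nonneg)
  qed (use nonneg in auto)
  then have "h absolutely_integrable_on {a..}"
    using nonneg by (intro nonnegative_absolutely_integrable_1) auto
  moreover have "(\<lambda>s. indicator {a..} s *\<^sub>R h s) \<in> borel_measurable lborel"
    using borel_measurable_continuous_on_indicator[OF _ cont] by simp
  ultimately show ?thesis
    unfolding set_integrable_def by (simp add: integrable_completion)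
qed

text \<open>The function \<open>E + \<integral>w - \<integral>k\<close> is nonincreasing on \<open>{T..}\<close>, and \<open>\<integral>k\<close> stays bounded. The
  integrals start at \<open>a < T\<close> so that every \<open>t \<ge> T\<close> is an interior point of their domain and
  their derivatives at \<open>t\<close> are two-sided.\<close>

lemma dissipation_bound:
  fixes E w k :: "real \<Rightarrow> real"
  assumes "a < T"
    and w: "continuous_on {a..} w" and k: "continuous_on {a..} k"
    and k_nonneg: "\<And>t. a \<le> t \<Longrightarrow> 0 \<le> k t" and k_int: "set_integrable lborel {a..} k"
    and decay: "\<And>t. T \<le> t \<Longrightarrow> \<exists>D. (E has_real_derivative D) (at t) \<and> D + w t \<le> k t"
  obtains B where "\<And>t. T \<le> t \<Longrightarrow> E t + integral {a..t} w \<le> B"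
proof -
  have antiderivative: "((\<lambda>s. integral {a..s} h) has_real_derivative h t) (at t)"
    if "continuous_on {a..} h" "T \<le> t" for h :: "real \<Rightarrow> real" and t
  proof -
    have "((\<lambda>s. integral {a..s} h) has_real_derivative h t) (at t within {a..t + 1})"
      using that \<open>a < T\<close>
      by (intro integral_has_real_derivative continuous_on_subset[OF that(1)]) auto
    moreover have "at t within {a..t + 1} = at t"
      using that \<open>a < T\<close> by (intro at_within_interior) simp
    ultimately show ?thesis by simp
  qed
  let ?F = "\<lambda>t. E t + integral {a..t} w - integral {a..t} k"
  have "?F t \<le> ?F T" if "T \<le> t" for t
  proof (rule DERIV_nonpos_imp_nonincreasing[OF that])
    fix s assume "T \<le> s"
    from decay[OF this] obtain D where D: "(E has_real_derivative D) (at s)" "D + w s \<le> k s"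
      by blast
    have "(?F has_real_derivative D + w s - k s) (at s)"
      by (intro DERIV_diff DERIV_add D antiderivative w k \<open>T \<le> s\<close>)
    with D show "\<exists>y. (?F has_real_derivative y) (at s) \<and> y \<le> 0" by force
  qed
  moreover have k_on: "k integrable_on {a..t}" for t
    by (rule integrable_continuous_interval) (rule continuous_on_subset[OF k], auto)
  have "integral {a..t} k \<le> integral {a..} k" for t
    using set_borel_integral_eq_integral(1)[OF k_int] k_nonneg k_on
    by (intro integral_subset_le) auto
  moreover have "0 \<le> integral {a..T} k"
    using k_nonneg by (intro integral_nonneg k_on) auto
  ultimately have "E t + integral {a..t} w \<le> E T + integral {a..T} w + integral {a..} k"
    if "T \<le> t" for t
    using that by (smt (verit))
  then show ?thesis using that by blast
qed

section \<open>The forces and the primal-dual gap\<close>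

text \<open>The factor of \<open>r\<close> on the left is the derivative of the gap along a trajectory with velocities
  \<open>x'\<close> and \<open>y'\<close>. With \<open>X = x + (r/a) x'\<close> and \<open>Y = y + (r/a) y'\<close> one has
  \<open>r x' + a (x - xs) = a (X - xs)\<close> and likewise for \<open>y\<close>, so the coupling part of the right-hand side
  is \<open>a (\<langle>K (X - xs), Y\<rangle> - \<langle>K X, Y - ys\<rangle>) = a (\<langle>K X, ys\<rangle> - \<langle>K xs, Y\<rangle>)\<close>. This is linear in the
  trajectory and equals the coupling part of the left-hand side. What remains is the gradient
  inequality for \<open>f\<close> and \<open>g\<close>.\<close>

lemma lagrangian_gap_pairing:
  fixes f :: "'a::euclidean_space \<Rightarrow> real" and g :: "'b::euclidean_space \<Rightarrow> real"
  assumes f: "convex_on UNIV f" "f differentiable (at x)"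
    and g: "convex_on UNIV g" "g differentiable (at y)"
    and K: "linear K" and a: "0 < a"
  shows "r * (gradient f x \<bullet> x' + K x' \<bullet> ys - K xs \<bullet> y' + gradient g y \<bullet> y')
      + a * (lagrangian f K g x ys - lagrangian f K g xs y)
    \<le> (r *\<^sub>R x' + a *\<^sub>R (x - xs)) \<bullet> (gradient f x + adjoint K (y + (r / a) *\<^sub>R y'))
      + (r *\<^sub>R y' + a *\<^sub>R (y - ys)) \<bullet> (gradient g y - K (x + (r / a) *\<^sub>R x'))"
    (is "?l \<le> ?r")
proof -
  note [simp] = linear_add[OF K] linear_diff[OF K] linear_cmul[OF K] adjoint_works[OF K]
  have "a * (f x - f xs + (g y - g ys))
      \<le> a * (gradient f x \<bullet> (x - xs) + gradient g y \<bullet> (y - ys))"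
    using a convex_on_above_gradient[OF f, of xs] convex_on_above_gradient[OF g, of ys]
    by (intro mult_left_mono add_mono) auto
  moreover have "?r - ?l = a * (gradient f x \<bullet> (x - xs) + gradient g y \<bullet> (y - ys))
      - a * (f x - f xs + (g y - g ys))"
    using a unfolding lagrangian_def
    by (simp add: inner_add_left inner_add_right inner_diff_left inner_diff_right
        inner_commute[of _ "K _"] inner_commute[of "gradient _ _"] field_simps)
  ultimately show ?thesis by linarith
qed


section \<open>The energy of one block\<close>

text \<open>The second summand is the correction that cancels the term \<open>\<langle>x - xs, x'\<rangle>\<close> in the derivative of
  the first. Its weight is written with \<open>t\<^sup>q / t\<close> instead of \<open>t\<^sup>q\<^sup>-\<^sup>1\<close>, and the last one with
  \<open>(t\<^sup>q)\<^sup>2 t\<^sup>-\<^sup>p\<close> instead of \<open>t\<^sup>2\<^sup>q\<^sup>-\<^sup>p\<close>, so that computations are polynomial in \<open>t\<^sup>q\<close>, \<open>t\<^sup>-\<^sup>p\<close> and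
  \<open>1 / t\<close>.\<close>

definition block_energy ::
    "real \<Rightarrow> real \<Rightarrow> real \<Rightarrow> real \<Rightarrow> (real \<Rightarrow> real) \<Rightarrow> 'a::real_inner
      \<Rightarrow> (real \<Rightarrow> 'a) \<Rightarrow> (real \<Rightarrow> 'a) \<Rightarrow> real \<Rightarrow> real" where
  "block_energy a q p c \<beta> xs x x' t =
     (norm (t powr q *\<^sub>R x' t + a *\<^sub>R (x t - xs)))\<^sup>2 / 2
     + a / 2 * (1 - q * (t powr q / t)) * (norm (x t - xs))\<^sup>2
     + c / 2 * ((t powr q)\<^sup>2 * t powr (- p) * \<beta> t) * (norm (x t))\<^sup>2"

text \<open>The Tikhonov term is what makes the energy decay. It pairs with \<open>a (x - xs)\<close> to give
  \<open>\<langle>x, x - xs\<rangle> = (\<bar>x\<bar>\<^sup>2 + \<bar>x - xs\<bar>\<^sup>2 - \<bar>xs\<bar>\<^sup>2) / 2\<close>. The part with \<open>\<bar>x\<bar>\<^sup>2\<close> absorbs the growth of the last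
  weight in the energy (this uses \<open>growth\<close>), the part with \<open>\<bar>x - xs\<bar>\<^sup>2\<close> absorbs the growth of the
  correction weight (this uses \<open>lower\<close>), and the part with \<open>\<bar>xs\<bar>\<^sup>2\<close> is the right-hand side of the
  estimate.\<close>

lemma block_energy_decay:
  fixes x x' :: "real \<Rightarrow> 'a::real_inner"
  assumes params: "0 < a" "0 < q" "q < 1" "0 < p" "0 < c" and t: "1 \<le> t" and \<beta>: "0 < \<beta> t"
    and d\<beta>: "(\<beta> has_real_derivative \<beta>') (at t)"
    and dx: "(x has_vector_derivative x' t) (at t)"
    and dx': "(x' has_vector_derivative x'') (at t)"
    and ode: "x'' + ((a + 1) / t powr q) *\<^sub>R x' t
        + \<beta> t *\<^sub>R (G + (c / t powr p) *\<^sub>R x t) = 0"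
    and growth: "\<beta>' / \<beta> t \<le> a / t powr q - 2 * q / t"
    and lower: "q * (1 - q) / c \<le> t powr (2 - p) * \<beta> t"
  shows "\<exists>D. (block_energy a q p c \<beta> xs x x' has_real_derivative D) (at t) \<and>
    D + \<beta> t * t powr q * ((t powr q *\<^sub>R x' t + a *\<^sub>R (x t - xs)) \<bullet> G)
      + (1 - q) * (t powr q * (norm (x' t))\<^sup>2)
    \<le> a * c / 2 * (norm xs)\<^sup>2 * (t powr (q - p) * \<beta> t)"
proof -
  define r s where "r = t powr q" and "s = t powr (- p)"
  define u where "u = x t - xs"
  have "0 < t" using t by simp
  have r: "0 < r" and s: "0 < s" using \<open>0 < t\<close> by (simp_all add: r_def s_def)
  have dr: "((\<lambda>t. t powr q) has_real_derivative q * (r / t)) (at t)"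
    using has_real_derivative_powr[OF \<open>0 < t\<close>, of q] \<open>0 < t\<close> by (simp add: r_def powr_diff)
  have ds: "((\<lambda>t. t powr (- p)) has_real_derivative - p * (s / t)) (at t)"
    using has_real_derivative_powr[OF \<open>0 < t\<close>, of "- p"] \<open>0 < t\<close> by (simp add: s_def powr_diff)
  \<comment> \<open>The damping \<open>a + 1\<close> leaves \<open>- x'\<close> after the \<open>a x'\<close> from \<open>a (x - xs)\<close> is added below.\<close>
  have rx'': "r *\<^sub>R x'' = - ((a + 1) *\<^sub>R x' t) - (r * \<beta> t) *\<^sub>R (G + (c * s) *\<^sub>R x t)"
  proof -
    have "x'' = - (((a + 1) / r) *\<^sub>R x' t) - \<beta> t *\<^sub>R (G + (c * s) *\<^sub>R x t)"
      using ode unfolding r_def s_def powr_minus divide_inverse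
      by (simp add: eq_neg_iff_add_eq_0 algebra_simps)
    then show ?thesis using r by (simp add: scaleR_right_diff_distrib)
  qed
  let ?v' = "(q * (r / t) - 1) *\<^sub>R x' t - (r * \<beta> t) *\<^sub>R (G + (c * s) *\<^sub>R x t)"
  have du: "((\<lambda>t. x t - xs) has_vector_derivative x' t) (at t)"
    using dx by (auto intro!: derivative_eq_intros)
  have "((\<lambda>t. t powr q *\<^sub>R x' t + a *\<^sub>R (x t - xs)) has_vector_derivative
      (r *\<^sub>R x'' + (q * (r / t)) *\<^sub>R x' t) + a *\<^sub>R x' t) (at t)"
    unfolding r_def
    by (intro has_vector_derivative_add has_vector_derivative_scaleR dr[unfolded r_def] dx'
        bounded_linear.has_vector_derivative[OF bounded_linear_scaleR_right] du)
  also have "(r *\<^sub>R x'' + (q * (r / t)) *\<^sub>R x' t) + a *\<^sub>R x' t = ?v'"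
    unfolding rx'' by (simp add: algebra_simps)
  finally have dv: "((\<lambda>t. t powr q *\<^sub>R x' t + a *\<^sub>R (x t - xs)) has_vector_derivative ?v') (at t)" .
  define W where "W = r\<^sup>2 * s * \<beta> t"
  define W' where "W' = r\<^sup>2 * s * (2 * q / t * \<beta> t + \<beta>') - p * (W / t)"
  have dW: "((\<lambda>t. (t powr q)\<^sup>2 * t powr (- p) * \<beta> t) has_real_derivative W') (at t)"
    by (rule derivative_eq_intros dr ds d\<beta> refl)+
       (simp add: W'_def W_def r_def s_def power2_eq_square algebra_simps)
  have dc: "((\<lambda>t. 1 - q * (t powr q / t)) has_real_derivative q * (1 - q) * (r / t\<^sup>2)) (at t)"
  proof -
    have "((\<lambda>t. t powr q / t) has_real_derivative (q * (r / t) * t - r) / (t * t)) (at t)"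
      using DERIV_divide[OF dr DERIV_ident] \<open>0 < t\<close> by (simp add: r_def)
    from DERIV_diff[OF DERIV_const DERIV_cmult[OF this, of q]] show ?thesis
      by (rule DERIV_cong) (use \<open>0 < t\<close> in \<open>simp add: power2_eq_square field_simps\<close>)
  qed
  define v where "v = r *\<^sub>R x' t + a *\<^sub>R u"
  define D where "D = v \<bullet> ?v' + (a / 2 * (1 - q * (r / t)) * (2 * (u \<bullet> x' t))
      + a / 2 * (q * (1 - q) * (r / t\<^sup>2)) * (norm u)\<^sup>2)
      + (c / 2 * W * (2 * (x t \<bullet> x' t)) + c / 2 * W' * (norm (x t))\<^sup>2)"
  have "(block_energy a q p c \<beta> xs x x' has_real_derivative D) (at t)"
    unfolding block_energy_def[abs_def]
    by (rule DERIV_cong[OF DERIV_add[OF DERIV_add[OF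
            DERIV_cdivide[OF has_real_derivative_norm_power2[OF dv], of 2]
            DERIV_mult[OF DERIV_cmult[OF dc, of "a / 2"] has_real_derivative_norm_power2[OF du]]]
            DERIV_mult[OF DERIV_cmult[OF dW, of "c / 2"] has_real_derivative_norm_power2[OF dx]]]])
       (simp add: D_def v_def W_def r_def s_def u_def)
  moreover have "D + \<beta> t * r * (v \<bullet> G) + (1 - q) * (r * (norm (x' t))\<^sup>2)
      \<le> a * c / 2 * (norm xs)\<^sup>2 * (r * s * \<beta> t)"
  proof -
    have "xs = x t - u" by (simp add: u_def)
    then have "(norm xs)\<^sup>2 = (norm (x t))\<^sup>2 + (norm u)\<^sup>2 - 2 * (x t \<bullet> u)"
      by (simp add: power2_norm_eq_inner inner_diff_left inner_diff_right inner_commute)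
    then have ux: "x t \<bullet> u = ((norm (x t))\<^sup>2 + (norm u)\<^sup>2 - (norm xs)\<^sup>2) / 2" by simp
    have vv: "v \<bullet> ?v' = r * (q * (r / t) - 1) * (norm (x' t))\<^sup>2 + a * (q * (r / t) - 1) * (u \<bullet> x' t)
        - \<beta> t * r * (v \<bullet> G) - c * W * (x t \<bullet> x' t) - a * c * (r * s * \<beta> t) * (x t \<bullet> u)"
      unfolding v_def W_def power2_norm_eq_inner
      by (simp add: inner_add_left inner_add_right inner_diff_right inner_commute
          power2_eq_square algebra_simps)
    \<comment> \<open>The three brackets below are nonpositive: by \<open>t\<^sup>q \<le> t\<close>, by \<open>lower\<close> and by \<open>growth\<close>.\<close>
    have "D + \<beta> t * r * (v \<bullet> G) + (1 - q) * (r * (norm (x' t))\<^sup>2)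
        - a * c / 2 * (norm xs)\<^sup>2 * (r * s * \<beta> t)
      = r * q * (r / t - 1) * (norm (x' t))\<^sup>2
        + a * r / 2 * (q * (1 - q) / t\<^sup>2 - c * s * \<beta> t) * (norm u)\<^sup>2
        + c / 2 * (W' - a * r * s * \<beta> t) * (norm (x t))\<^sup>2"
      unfolding D_def vv ux using \<open>0 < t\<close> by (simp add: field_simps power2_eq_square[of t])
    moreover have "r / t \<le> 1"
      using powr_mono[of q 1 t] t params by (simp add: r_def)
    then have "r * q * (r / t - 1) * (norm (x' t))\<^sup>2 \<le> 0"
      using r params by (intro mult_nonpos_nonneg mult_nonneg_nonpos) auto
    moreover have "q * (1 - q) / t\<^sup>2 \<le> c * s * \<beta> t"
    proof -
      have "t powr (2 - p) = t\<^sup>2 * s"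
        using \<open>0 < t\<close> by (simp add: s_def powr_diff powr_minus powr_realpow divide_inverse)
      then show ?thesis using lower params \<open>0 < t\<close> by (simp add: field_simps)
    qed
    then have "a * r / 2 * (q * (1 - q) / t\<^sup>2 - c * s * \<beta> t) * (norm u)\<^sup>2 \<le> 0"
      using r params by (intro mult_nonpos_nonneg mult_nonneg_nonpos) auto
    moreover have "W' \<le> a * r * s * \<beta> t"
    proof -
      have "2 * q / t * \<beta> t + \<beta>' \<le> a / r * \<beta> t"
        using growth \<beta> unfolding r_def[symmetric] by (simp add: field_simps)
      then have "r\<^sup>2 * s * (2 * q / t * \<beta> t + \<beta>') \<le> r\<^sup>2 * s * (a / r * \<beta> t)"
        using r s by (intro mult_left_mono) auto
      also have "\<dots> = a * r * s * \<beta> t" using r by (simp add: power2_eq_square)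
      finally have "r\<^sup>2 * s * (2 * q / t * \<beta> t + \<beta>') \<le> a * r * s * \<beta> t" .
      moreover have "0 \<le> p * (W / t)" using params r s \<beta> t by (simp add: W_def)
      ultimately show ?thesis unfolding W'_def by linarith
    qed
    then have "c / 2 * (W' - a * r * s * \<beta> t) * (norm (x t))\<^sup>2 \<le> 0"
      using params by (intro mult_nonpos_nonneg mult_nonneg_nonpos) auto
    ultimately show ?thesis by linarith
  qed
  moreover have "t powr (q - p) = r * s"
    using \<open>0 < t\<close> by (simp add: r_def s_def powr_diff powr_minus divide_inverse)
  ultimately show ?thesis unfolding v_def u_def r_def by auto
qed

text \<open>For \<open>t \<ge> 1\<close> one has \<open>t\<^sup>q \<le> t\<close>, so the correction weight is at least \<open>a/2 (1 - q) > 0\<close> and the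
  energy controls the distance to \<open>xs\<close> and, by the triangle inequality, the velocity.\<close>

lemma block_energy_bounds:
  fixes x x' :: "real \<Rightarrow> 'a::real_inner"
  assumes params: "0 < a" "0 < q" "q < 1" "0 \<le> c" and t: "1 \<le> t" and \<beta>: "0 \<le> \<beta> t"
    and E: "block_energy a q p c \<beta> xs x x' t \<le> M"
  shows "0 \<le> block_energy a q p c \<beta> xs x x' t"
    and "norm (x t - xs) \<le> sqrt (2 * M / (a * (1 - q)))"
    and "t powr q * norm (x' t) \<le> sqrt (2 * M) + a * sqrt (2 * M / (a * (1 - q)))"
proof -
  define V where "V = (norm (t powr q *\<^sub>R x' t + a *\<^sub>R (x t - xs)))\<^sup>2"
  define U where "U = (norm (x t - xs))\<^sup>2"
  have nonneg: "0 \<le> V" "0 \<le> U" by (simp_all add: V_def U_def)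
  have "t powr q / t \<le> 1" using powr_mono[of q 1 t] t params by simp
  then have "q * (t powr q / t) \<le> q"
    using mult_left_mono[of "t powr q / t" 1 q] params by simp
  then have "a / 2 * (1 - q) * U \<le> a / 2 * (1 - q * (t powr q / t)) * U"
    using params nonneg by (intro mult_right_mono mult_left_mono) auto
  moreover have "0 \<le> c / 2 * ((t powr q)\<^sup>2 * t powr (- p) * \<beta> t) * (norm (x t))\<^sup>2"
    using params \<beta> by simp
  ultimately have lb: "V / 2 + a / 2 * (1 - q) * U \<le> block_energy a q p c \<beta> xs x x' t"
    unfolding block_energy_def V_def U_def by linarith
  have aU: "0 \<le> a / 2 * (1 - q) * U" using params nonneg by simp
  show "0 \<le> block_energy a q p c \<beta> xs x x' t" using lb nonneg aU by linarith
  have "V \<le> 2 * M" using lb aU E by linarith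
  then have v: "norm (t powr q *\<^sub>R x' t + a *\<^sub>R (x t - xs)) \<le> sqrt (2 * M)"
    unfolding V_def by (rule real_le_rsqrt)
  have "a / 2 * (1 - q) * U \<le> M" using lb nonneg E by linarith
  then have "U \<le> 2 * M / (a * (1 - q))" using params by (simp add: field_simps)
  then show u: "norm (x t - xs) \<le> sqrt (2 * M / (a * (1 - q)))"
    unfolding U_def by (rule real_le_rsqrt)
  have "t powr q * norm (x' t)
      = norm ((t powr q *\<^sub>R x' t + a *\<^sub>R (x t - xs)) - a *\<^sub>R (x t - xs))" by simp
  also have "\<dots> \<le> norm (t powr q *\<^sub>R x' t + a *\<^sub>R (x t - xs)) + norm (a *\<^sub>R (x t - xs))"
    by (rule norm_triangle_ineq4)
  also have "\<dots> \<le> sqrt (2 * M) + a * sqrt (2 * M / (a * (1 - q)))"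
    using v u params by (intro add_mono) auto
  finally show "t powr q * norm (x' t) \<le> sqrt (2 * M) + a * sqrt (2 * M / (a * (1 - q)))" .
qed

section \<open>Convergence rates along trajectories\<close>

theorem theorem3p1:
  fixes f :: "real ^ 'n \<Rightarrow> real" and g :: "real ^ 'm \<Rightarrow> real"
    and K :: "real ^ 'n \<Rightarrow> real ^ 'm"
    and L :: "real ^ 'n \<Rightarrow> real ^ 'm \<Rightarrow> real"
    and t\<^sub>0 \<alpha> q p c :: real
    and \<beta> \<beta>' :: "real \<Rightarrow> real"
    and x x' x'' :: "real \<Rightarrow> real ^ 'n"
    and y y' y'' :: "real \<Rightarrow> real ^ 'm"
  assumes f: "C1_function f" "convex_on UNIV f"
    and g: "C1_function g" "convex_on UNIV g"
    and K: "bounded_linear K"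
    and L: "L = lagrangian f K g"
    and saddle: "saddle_points L \<noteq> {}"
    and params: "t\<^sub>0 > 0" "\<alpha> > 1" "0 < q" "q < 1" "p > 0" "c > 0"
    and \<beta>_pos: "\<And>t. t \<ge> t\<^sub>0 \<Longrightarrow> \<beta> t > 0"
    and \<beta>_deriv: "\<And>t. t \<ge> t\<^sub>0 \<Longrightarrow> (\<beta> has_real_derivative \<beta>' t) (at t within {t\<^sub>0..})"
    and \<beta>'_cont: "continuous_on {t\<^sub>0..} \<beta>'"
    and \<beta>_mono: "mono_on {t\<^sub>0..} \<beta>"
    and x_deriv: "\<And>t. t \<ge> t\<^sub>0 \<Longrightarrow> (x has_vector_derivative x' t) (at t within {t\<^sub>0..})"
    and x'_deriv: "\<And>t. t \<ge> t\<^sub>0 \<Longrightarrow> (x' has_vector_derivative x'' t) (at t within {t\<^sub>0..})"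
    and y_deriv: "\<And>t. t \<ge> t\<^sub>0 \<Longrightarrow> (y has_vector_derivative y' t) (at t within {t\<^sub>0..})"
    and y'_deriv: "\<And>t. t \<ge> t\<^sub>0 \<Longrightarrow> (y' has_vector_derivative y'' t) (at t within {t\<^sub>0..})"
    and ode_x: "\<And>t. t \<ge> t\<^sub>0 \<Longrightarrow>
      x'' t + (\<alpha> / t powr q) *\<^sub>R x' t
        + \<beta> t *\<^sub>R (gradient_x L (x t) (y t + (t powr q / (\<alpha> - 1)) *\<^sub>R y' t)
                   + (c / t powr p) *\<^sub>R x t) = 0"
    and ode_y: "\<And>t. t \<ge> t\<^sub>0 \<Longrightarrow>
      y'' t + (\<alpha> / t powr q) *\<^sub>R y' t
        - \<beta> t *\<^sub>R (gradient_y L (x t + (t powr q / (\<alpha> - 1)) *\<^sub>R x' t) (y t)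
                   - (c / t powr p) *\<^sub>R y t) = 0"
    and growth: "\<And>t. t \<ge> t\<^sub>0 \<Longrightarrow> \<beta>' t / \<beta> t \<le> (\<alpha> - 1) / t powr q - 2 * q / t"
    and lower: "\<And>t. t \<ge> t\<^sub>0 \<Longrightarrow> q * (1 - q) / c \<le> t powr (2 - p) * \<beta> t"
    and int: "set_integrable lborel {t\<^sub>0..} (\<lambda>t. t powr (q - p) * \<beta> t)"
  shows "\<forall>(xs, ys) \<in> saddle_points L.
      bounded ((\<lambda>t. (x t, y t)) ` {t\<^sub>0..}) \<and>
      (\<lambda>t. L (x t) ys - L xs (y t)) \<in> O[at_top](\<lambda>t. 1 / (t powr (2 * q) * \<beta> t)) \<and>
      (\<lambda>t. norm (x' t)) \<in> O[at_top](\<lambda>t. 1 / t powr q) \<and>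
      (\<lambda>t. norm (y' t)) \<in> O[at_top](\<lambda>t. 1 / t powr q) \<and>
      set_integrable lborel {t\<^sub>0..} (\<lambda>t. t powr q * ((norm (x' t))\<^sup>2 + (norm (y' t))\<^sup>2))"
proof (intro ballI, clarify)
  fix xs ys assume saddle_xs: "(xs, ys) \<in> saddle_points L"
  define a where "a = \<alpha> - 1"
  have a: "0 < a" "\<alpha> = a + 1" using params by (simp_all add: a_def)
  have "linear K" using K by (rule bounded_linear.linear)
  have f_diff: "f differentiable (at z)" for z using f by (simp add: C1_function_def)
  have g_diff: "g differentiable (at z)" for z using g by (simp add: C1_function_def)
  define gap where "gap t = L (x t) ys - L xs (y t)" for t
  have gap_nonneg: "0 \<le> gap t" for t
  proof -
    have "L xs (y t) \<le> L xs ys" "L xs ys \<le> L (x t) ys"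
      using saddle_xs by (simp_all add: saddle_points_def)
    then show ?thesis by (simp add: gap_def)
  qed
  define Gx where "Gx t = gradient f (x t) + adjoint K (y t + (t powr q / a) *\<^sub>R y' t)" for t
  define Gy where "Gy t = gradient g (y t) - K (x t + (t powr q / a) *\<^sub>R x' t)" for t
  have block_x: "x'' t + ((a + 1) / t powr q) *\<^sub>R x' t
      + \<beta> t *\<^sub>R (Gx t + (c / t powr p) *\<^sub>R x t) = 0" if "t\<^sub>0 \<le> t" for t
    using ode_x[OF that] unfolding L gradient_x_lagrangian[OF f_diff \<open>linear K\<close>] Gx_def a_def
    by simp
  have block_y: "y'' t + ((a + 1) / t powr q) *\<^sub>R y' t
      + \<beta> t *\<^sub>R (Gy t + (c / t powr p) *\<^sub>R y t) = 0" if "t\<^sub>0 \<le> t" for t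
    using ode_y[OF that] unfolding L gradient_y_lagrangian[OF g_diff] Gy_def a_def
    by (simp add: algebra_simps)

  \<comment> \<open>Past \<open>t\<^sub>0\<close> the one-sided derivatives become two-sided, and past 1 the energy is nonnegative.\<close>
  define T where "T = t\<^sub>0 + 1"
  have T: "t\<^sub>0 < T" "1 \<le> T" using params by (simp_all add: T_def)
  have at_eq: "at t within {t\<^sub>0..} = at t" if "T \<le> t" for t
    using that T by (intro at_within_interior) simp
  let ?Bx = "block_energy a q p c \<beta> xs x x'" and ?By = "block_energy a q p c \<beta> ys y y'"
  define E where "E t = (t powr q)\<^sup>2 * \<beta> t * gap t + ?Bx t + ?By t" for t
  define w where "w t = t powr q * ((norm (x' t))\<^sup>2 + (norm (y' t))\<^sup>2)" for t
  define C where "C = a * c / 2 * ((norm xs)\<^sup>2 + (norm ys)\<^sup>2)"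
  have decay: "\<exists>D. (E has_real_derivative D) (at t) \<and> D + (1 - q) * w t \<le> C * (t powr (q - p) * \<beta> t)"
    if "T \<le> t" for t
  proof -
    have t: "1 \<le> t" "0 < t" "t\<^sub>0 \<le> t" using that T by auto
    note at = at_eq[OF that]
    define r where "r = t powr q"
    have r: "0 < r" using t by (simp add: r_def)
    have \<beta>: "0 < \<beta> t" using \<beta>_pos t by simp
    have d\<beta>: "(\<beta> has_real_derivative \<beta>' t) (at t)" using \<beta>_deriv[OF t(3)] at by simp
    have dx: "(x has_vector_derivative x' t) (at t)" using x_deriv[OF t(3)] at by simp
    have dx': "(x' has_vector_derivative x'' t) (at t)" using x'_deriv[OF t(3)] at by simp
    have dy: "(y has_vector_derivative y' t) (at t)" using y_deriv[OF t(3)] at by simp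
    have dy': "(y' has_vector_derivative y'' t) (at t)" using y'_deriv[OF t(3)] at by simp
    have growth_t: "\<beta>' t / \<beta> t \<le> a / t powr q - 2 * q / t"
      using growth[OF t(3)] by (simp add: a_def)
    define P where "P = (r *\<^sub>R x' t + a *\<^sub>R (x t - xs)) \<bullet> Gx t"
    define Q where "Q = (r *\<^sub>R y' t + a *\<^sub>R (y t - ys)) \<bullet> Gy t"
    obtain Dx where Dx: "(?Bx has_real_derivative Dx) (at t)"
      "Dx + \<beta> t * r * P + (1 - q) * (r * (norm (x' t))\<^sup>2)
        \<le> a * c / 2 * (norm xs)\<^sup>2 * (t powr (q - p) * \<beta> t)"
      using block_energy_decay[OF a(1) params(3-6) t(1) \<beta> d\<beta> dx dx' block_x[OF t(3)]
          growth_t lower[OF t(3)]] unfolding P_def r_def by blast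
    obtain Dy where Dy: "(?By has_real_derivative Dy) (at t)"
      "Dy + \<beta> t * r * Q + (1 - q) * (r * (norm (y' t))\<^sup>2)
        \<le> a * c / 2 * (norm ys)\<^sup>2 * (t powr (q - p) * \<beta> t)"
      using block_energy_decay[OF a(1) params(3-6) t(1) \<beta> d\<beta> dy dy' block_y[OF t(3)]
          growth_t lower[OF t(3)]] unfolding Q_def r_def by blast
    define g' where "g' = gradient f (x t) \<bullet> x' t + K (x' t) \<bullet> ys - K xs \<bullet> y' t
      + gradient g (y t) \<bullet> y' t"
    have dgap: "(gap has_real_derivative g') (at t)"
    proof -
      have dK: "((\<lambda>t. K (x t) \<bullet> ys) has_real_derivative K (x' t) \<bullet> ys) (at t)"
        using bounded_linear.has_vector_derivative[OF bounded_linear_compose[OF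
            bounded_linear_inner_left K] dx, of ys]
        by (simp add: has_real_derivative_iff_has_vector_derivative)
      have dy_in: "((\<lambda>t. K xs \<bullet> y t) has_real_derivative K xs \<bullet> y' t) (at t)"
        using bounded_linear.has_vector_derivative[OF bounded_linear_inner_right dy, of "K xs"]
        by (simp add: has_real_derivative_iff_has_vector_derivative)
      show ?thesis
        unfolding gap_def[abs_def] L lagrangian_def g'_def
        by (rule derivative_eq_intros dK dy_in refl
            has_real_derivative_along_curve[OF f_diff dx]
            has_real_derivative_along_curve[OF g_diff dy])+ simp
    qed
    have pairing: "r * g' + a * gap t \<le> P + Q"
      unfolding g'_def gap_def L P_def Q_def Gx_def Gy_def r_def
      by (rule lagrangian_gap_pairing[OF f(2) f_diff g(2) g_diff \<open>linear K\<close> a(1)])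
    have dr: "((\<lambda>t. t powr q) has_real_derivative q * (r / t)) (at t)"
      using has_real_derivative_powr[OF t(2), of q] t by (simp add: r_def powr_diff)
    define H where "H = r\<^sup>2 * (2 * q / t * \<beta> t + \<beta>' t) * gap t + r\<^sup>2 * \<beta> t * g'"
    have "((\<lambda>t. (t powr q)\<^sup>2 * \<beta> t * gap t) has_real_derivative H) (at t)"
      by (rule derivative_eq_intros dr d\<beta> dgap refl)+
         (simp add: H_def r_def power2_eq_square algebra_simps)
    then have "(E has_real_derivative H + Dx + Dy) (at t)"
      unfolding E_def[abs_def] by (intro DERIV_add Dx Dy)
    moreover have "H \<le> \<beta> t * r * P + \<beta> t * r * Q"
    proof -
      have "2 * q / t * \<beta> t + \<beta>' t \<le> a / r * \<beta> t"
        using growth_t \<beta> unfolding r_def[symmetric] by (simp add: field_simps)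
      then have "r\<^sup>2 * (2 * q / t * \<beta> t + \<beta>' t) * gap t \<le> r\<^sup>2 * (a / r * \<beta> t) * gap t"
        using r gap_nonneg by (intro mult_right_mono mult_left_mono) auto
      then have "H \<le> \<beta> t * r * (r * g' + a * gap t)"
        using r unfolding H_def by (simp add: power2_eq_square algebra_simps)
      also have "\<dots> \<le> \<beta> t * r * (P + Q)"
        using pairing r \<beta> by (intro mult_left_mono) auto
      finally show ?thesis by (simp add: distrib_left)
    qed
    moreover have "(1 - q) * w t = (1 - q) * (r * (norm (x' t))\<^sup>2) + (1 - q) * (r * (norm (y' t))\<^sup>2)"
      and "C * (t powr (q - p) * \<beta> t) = a * c / 2 * (norm xs)\<^sup>2 * (t powr (q - p) * \<beta> t)
        + a * c / 2 * (norm ys)\<^sup>2 * (t powr (q - p) * \<beta> t)"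
      by (simp_all add: w_def C_def r_def algebra_simps add_divide_distrib)
    ultimately show ?thesis using Dx(2) Dy(2) by (intro exI[of _ "H + Dx + Dy"]) linarith
  qed

  have cont: "continuous_on {t\<^sub>0..} x" "continuous_on {t\<^sub>0..} x'"
    "continuous_on {t\<^sub>0..} y" "continuous_on {t\<^sub>0..} y'"
    using x_deriv x'_deriv y_deriv y'_deriv
    by (auto intro!: continuous_on_vector_derivative)
  have cont_\<beta>: "continuous_on {t\<^sub>0..} \<beta>" using \<beta>_deriv by (auto intro!: DERIV_continuous_on)
  have cont_w: "continuous_on {t\<^sub>0..} w"
    unfolding w_def[abs_def] using params cont by (intro continuous_intros) auto
  have w_nonneg: "0 \<le> w t" for t by (simp add: w_def)
  have "0 \<le> C" using a params by (simp add: C_def)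
  obtain M where M: "E t + integral {t\<^sub>0..t} (\<lambda>t. (1 - q) * w t) \<le> M" if "T \<le> t" for t
  proof (rule dissipation_bound[OF T(1) _ _ _ _ decay])
    show "continuous_on {t\<^sub>0..} (\<lambda>t. (1 - q) * w t)" by (intro continuous_intros cont_w)
    show "continuous_on {t\<^sub>0..} (\<lambda>t. C * (t powr (q - p) * \<beta> t))"
      using params by (intro continuous_intros cont_\<beta>) auto
    show "0 \<le> C * (t powr (q - p) * \<beta> t)" if "t\<^sub>0 \<le> t" for t
      using \<open>0 \<le> C\<close> \<beta>_pos[OF that] by simp
    show "set_integrable lborel {t\<^sub>0..} (\<lambda>t. C * (t powr (q - p) * \<beta> t))"
      using int by simp
  qed (use that in auto)

  define Rx where "Rx = sqrt (2 * M / (a * (1 - q)))"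
  define Rv where "Rv = sqrt (2 * M) + a * Rx"
  have bounds: "(t powr q)\<^sup>2 * \<beta> t * gap t \<le> M"
    "norm (x t - xs) \<le> Rx" "norm (y t - ys) \<le> Rx"
    "t powr q * norm (x' t) \<le> Rv" "t powr q * norm (y' t) \<le> Rv"
    "integral {t\<^sub>0..t} w \<le> M / (1 - q)" if "T \<le> t" for t
  proof -
    have t: "1 \<le> t" "t\<^sub>0 \<le> t" using that T by auto
    have \<beta>: "0 \<le> \<beta> t" using \<beta>_pos[OF t(2)] by simp
    have c: "0 \<le> c" using params by simp
    note be = block_energy_bounds[where t = t and \<beta> = \<beta>, OF a(1) params(3,4) c t(1) \<beta>]
    have nonneg: "0 \<le> (t powr q)\<^sup>2 * \<beta> t * gap t" "0 \<le> ?Bx t" "0 \<le> ?By t"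
      using be(1)[OF order.refl] \<beta> gap_nonneg by auto
    have "w integrable_on {t\<^sub>0..t}"
      by (rule integrable_continuous_interval) (rule continuous_on_subset[OF cont_w], auto)
    then have W: "0 \<le> integral {t\<^sub>0..t} w" using w_nonneg by (intro integral_nonneg) auto
    then have "0 \<le> (1 - q) * integral {t\<^sub>0..t} w" using params by simp
    moreover have sum: "(t powr q)\<^sup>2 * \<beta> t * gap t + ?Bx t + ?By t
        + (1 - q) * integral {t\<^sub>0..t} w \<le> M"
      using M[OF that] by (simp add: E_def)
    ultimately have le: "(t powr q)\<^sup>2 * \<beta> t * gap t \<le> M" "?Bx t \<le> M" "?By t \<le> M"
      "(1 - q) * integral {t\<^sub>0..t} w \<le> M"
      using nonneg by linarith+
    show "(t powr q)\<^sup>2 * \<beta> t * gap t \<le> M" by (fact le)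
    show "norm (x t - xs) \<le> Rx" "norm (y t - ys) \<le> Rx"
      using be(2)[OF le(2)] be(2)[OF le(3)] by (simp_all add: Rx_def)
    show "t powr q * norm (x' t) \<le> Rv" "t powr q * norm (y' t) \<le> Rv"
      using be(3)[OF le(2)] be(3)[OF le(3)] by (simp_all add: Rv_def Rx_def)
    show "integral {t\<^sub>0..t} w \<le> M / (1 - q)"
      using le(4) params by (simp add: field_simps)
  qed

  have "bounded ((\<lambda>t. (x t, y t)) ` {t\<^sub>0..T})"
    by (intro compact_imp_bounded compact_continuous_image continuous_on_Pair
        continuous_on_subset[OF cont(1)] continuous_on_subset[OF cont(3)]) auto
  moreover have "(\<lambda>t. (x t, y t)) ` {T..} \<subseteq> cball xs Rx \<times> cball ys Rx"
    using bounds(2,3) by (auto simp: dist_norm norm_minus_commute)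
  then have "bounded ((\<lambda>t. (x t, y t)) ` {T..})"
    by (rule bounded_subset[rotated]) (intro bounded_Times bounded_cball)
  ultimately have "bounded ((\<lambda>t. (x t, y t)) ` ({t\<^sub>0..T} \<union> {T..}))"
    by (simp add: image_Un)
  also have "{t\<^sub>0..T} \<union> {T..} = {t\<^sub>0..}" using T by auto
  finally have "bounded ((\<lambda>t. (x t, y t)) ` {t\<^sub>0..})" .
  moreover have "(\<lambda>t. L (x t) ys - L xs (y t)) \<in> O[at_top](\<lambda>t. 1 / (t powr (2 * q) * \<beta> t))"
  proof (rule bigoI, rule eventually_at_top_linorderI)
    fix t assume "T \<le> t"
    then have t: "0 < t" and \<beta>: "0 < \<beta> t" using T \<beta>_pos by auto
    have "t powr (2 * q) = (t powr q)\<^sup>2"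
      by (simp add: power2_eq_square flip: powr_add)
    then have "gap t \<le> M * (1 / (t powr (2 * q) * \<beta> t))"
      using bounds(1)[OF \<open>T \<le> t\<close>] t \<beta> by (simp add: field_simps)
    then show "norm (L (x t) ys - L xs (y t)) \<le> M * norm (1 / (t powr (2 * q) * \<beta> t))"
      using gap_nonneg[of t] \<beta> by (simp add: gap_def)
  qed
  moreover have speed: "(\<lambda>t. norm (z t)) \<in> O[at_top](\<lambda>t. 1 / t powr q)"
    if "\<And>t. T \<le> t \<Longrightarrow> t powr q * norm (z t) \<le> Rv" for z :: "real \<Rightarrow> 'c::real_normed_vector"
  proof (rule bigoI, rule eventually_at_top_linorderI)
    fix t assume "T \<le> t"
    then have "0 < t" using T by auto
    then show "norm (norm (z t)) \<le> Rv * norm (1 / t powr q)"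
      using that[OF \<open>T \<le> t\<close>] by (simp add: field_simps)
  qed
  note this[of x', OF bounds(4)] this[of y', OF bounds(5)]
  moreover have "set_integrable lborel {t\<^sub>0..} w"
    using bounds(6) w_nonneg by (intro set_integrable_if_bounded_integrals[OF cont_w])
  ultimately show "bounded ((\<lambda>t. (x t, y t)) ` {t\<^sub>0..}) \<and>
      (\<lambda>t. L (x t) ys - L xs (y t)) \<in> O[at_top](\<lambda>t. 1 / (t powr (2 * q) * \<beta> t)) \<and>
      (\<lambda>t. norm (x' t)) \<in> O[at_top](\<lambda>t. 1 / t powr q) \<and>
      (\<lambda>t. norm (y' t)) \<in> O[at_top](\<lambda>t. 1 / t powr q) \<and>
      set_integrable lborel {t\<^sub>0..} (\<lambda>t. t powr q * ((norm (x' t))\<^sup>2 + (norm (y' t))\<^sup>2))"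
    unfolding w_def[abs_def] by blast
qed

end
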